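(* Let $\Omega$ be a fixed sample space and let $\mathcal M$ be the set of all probability spaces over $\Omega$, i.e. pairs $(\mathcal F,\mu)$ with $\mathcal F$ a $\sigma$-algebra on $\Omega$ and $\mu$ a probability measure on $\mathcal F$. Let $\bullet:\mathcal M\times\mathcal M\rightharpoonup\mathcal M$ be the partial function mapping two probability spaces to their independent combination if it exists. Let $\sqsubseteq$ be the ordering with $(\mathcal F,\mu)\sqsubseteq(\mathcal G,\nu)$ iff $\mathcal F\subseteq\mathcal G$ and $\mu=\nu|_{\mathcal F}$. Let $\mathbf 1=(\{\emptyset,\Omega\},\mu_{\mathbf 1})$ be the trivial probability space, with $\mu_{\mathbf 1}(\Omega)=1$. Then $(\mathcal M,\sqsubseteq,\bullet,\mathbf 1)$ is a Kripke resource monoid.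
   Context: A sample space is a nonempty set. Independent combination: given probability spaces $(\Omega,\mathcal E,\mu)$ and $(\Omega,\mathcal F,\nu)$ over the same $\Omega$, a probability space $(\Omega,\mathcal G,\rho)$ is an independent combination of them if (1) $\mathcal G$ is the smallest $\sigma$-algebra containing $\mathcal E$ and $\mathcal F$, and (2) $\rho(E\cap F)=\mu(E)\nu(F)$ for all $E\in\mathcal E$, $F\in\mathcal F$. (An independent combination is unique when it exists, so $\bullet$ is a well-defined partial function.) Kripke resource monoid: a tuple $(\mathcal M,\sqsubseteq,\bullet,\mathbf 1)$ such that (1) $(\mathcal M,\sqsubseteq)$ is a poset; (2) $\bullet$ is a partial function $\mathcal M\times\mathcal M\rightharpoonup\mathcal M$; (3) $(\mathcal M,\bullet,\mathbf 1)$ is a partial commutative monoid (unit, commutativity and associativity hold, where in each equation one side is defined iff the other is, and then they are equal); (4) $\bullet$ respects $\sqsubseteq$: if $x\sqsubseteq x'$, $y\sqsubseteq y'$ and $x'\bullet y'$ is defined, then $x\bullet y$ is defined and $x\bullet y\sqsubseteq x'\bullet y'$. *)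

theory Defs
  imports "HOL-Probability.Probability_Measure"
begin

(* A partial function M x M -> M is encoded with option (None = undefined).  Equality of options
   then says that either side is defined iff the other one is, and that they are equal in that
   case; Option.bind propagates undefinedness through nested applications. *)

locale kripke_resource_monoid =
  fixes M :: "'m set"
    and le :: "'m \<Rightarrow> 'm \<Rightarrow> bool"
    and comb :: "'m \<Rightarrow> 'm \<Rightarrow> 'm option"
    and unit :: 'm
  assumes le_refl: "reflp_on M le"
    and le_antisym: "antisymp_on M le"
    and le_trans: "transp_on M le"
    and comb_closed: "\<lbrakk>x \<in> M; y \<in> M; comb x y = Some z\<rbrakk> \<Longrightarrow> z \<in> M"
    and unit_closed: "unit \<in> M"
    and comb_unit: "x \<in> M \<Longrightarrow> comb x unit = Some x"
    and comb_commute: "\<lbrakk>x \<in> M; y \<in> M\<rbrakk> \<Longrightarrow> comb x y = comb y x"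
    and comb_assoc: "\<lbrakk>x \<in> M; y \<in> M; z \<in> M\<rbrakk> \<Longrightarrow>
      Option.bind (comb x y) (\<lambda>w. comb w z) = Option.bind (comb y z) (\<lambda>w. comb x w)"
    and comb_mono: "\<lbrakk>x \<in> M; x' \<in> M; y \<in> M; y' \<in> M; le x x'; le y y'; comb x' y' = Some z'\<rbrakk> \<Longrightarrow>
      \<exists>z. comb x y = Some z \<and> le z z'"

(* emeasure of a measure is 0 outside its sigma-algebra, so an element of this set is determined
   by its sigma-algebra and the values of its measure there. *)

definition prob_spaces :: "'a set \<Rightarrow> 'a measure set" where
  "prob_spaces \<Omega> = {P. prob_space P \<and> space P = \<Omega>}"

definition prob_le :: "'a measure \<Rightarrow> 'a measure \<Rightarrow> bool" where
  "prob_le P Q \<longleftrightarrow> sets P \<subseteq> sets Q \<and> (\<forall>A\<in>sets P. emeasure P A = emeasure Q A)"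

definition is_indep_comb :: "'a set \<Rightarrow> 'a measure \<Rightarrow> 'a measure \<Rightarrow> 'a measure \<Rightarrow> bool" where
  "is_indep_comb \<Omega> P Q R \<longleftrightarrow>
     P \<in> prob_spaces \<Omega> \<and> Q \<in> prob_spaces \<Omega> \<and> R \<in> prob_spaces \<Omega> \<and>
     sets R = sigma_sets \<Omega> (sets P \<union> sets Q) \<and>
     (\<forall>E\<in>sets P. \<forall>F\<in>sets Q. emeasure R (E \<inter> F) = emeasure P E * emeasure Q F)"

lemma is_indep_comb_unique:
  assumes R: "is_indep_comb \<Omega> P Q R" and S: "is_indep_comb \<Omega> P Q S"
  shows "R = S"
proof -
  let ?G = "{E \<inter> F | E F. E \<in> sets P \<and> F \<in> sets Q}"
  have sp: "space P = \<Omega>" "space Q = \<Omega>"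
    using R by (auto simp: is_indep_comb_def prob_spaces_def)
  interpret R: prob_space R
    using R by (simp add: is_indep_comb_def prob_spaces_def)
  have G: "?G \<subseteq> Pow \<Omega>"
    using sets.sets_into_space[of _ P] sp by blast
  have PQ: "sets P \<union> sets Q \<subseteq> ?G"
  proof
    fix A assume "A \<in> sets P \<union> sets Q"
    moreover have "A = A \<inter> \<Omega>" "A = \<Omega> \<inter> A"
      using calculation sets.sets_into_space[of A P] sets.sets_into_space[of A Q] sp by auto
    moreover have "\<Omega> \<in> sets P" "\<Omega> \<in> sets Q"
      using sets.top[of P] sets.top[of Q] sp by auto
    ultimately show "A \<in> ?G" by blast
  qed
  have "sigma_sets \<Omega> (sets P \<union> sets Q) = sigma_sets \<Omega> ?G"
  proof
    show "sigma_sets \<Omega> (sets P \<union> sets Q) \<subseteq> sigma_sets \<Omega> ?G"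
      using PQ by (rule sigma_sets_mono')
    have sub: "sets P \<union> sets Q \<subseteq> Pow \<Omega>"
      using PQ G by blast
    interpret T: sigma_algebra \<Omega> "sigma_sets \<Omega> (sets P \<union> sets Q)"
      using sub by (rule sigma_algebra_sigma_sets)
    have "?G \<subseteq> sigma_sets \<Omega> (sets P \<union> sets Q)"
      by (auto intro!: T.Int)
    then show "sigma_sets \<Omega> ?G \<subseteq> sigma_sets \<Omega> (sets P \<union> sets Q)"
      by (rule sigma_sets_mono)
  qed
  then have sets: "sets R = sigma_sets \<Omega> ?G" "sets S = sigma_sets \<Omega> ?G"
    using R S by (auto simp: is_indep_comb_def)
  have stable: "Int_stable ?G"
  proof (rule Int_stableI)
    fix a b assume "a \<in> ?G" "b \<in> ?G"
    then obtain E F E' F' where *: "a = E \<inter> F" "b = E' \<inter> F'"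
      "E \<in> sets P" "F \<in> sets Q" "E' \<in> sets P" "F' \<in> sets Q" by blast
    then have "a \<inter> b = (E \<inter> E') \<inter> (F \<inter> F')" "E \<inter> E' \<in> sets P" "F \<inter> F' \<in> sets Q"
      by auto
    then show "a \<inter> b \<in> ?G" by blast
  qed
  have top: "\<Omega> \<in> ?G"
    using PQ sets.top[of P] sp by auto
  have eq: "emeasure R X = emeasure S X" if "X \<in> ?G" for X
    using that R S by (auto simp: is_indep_comb_def)
  show ?thesis
    using top by (intro measure_eqI_generator_eq[OF stable G eq sets, where A="\<lambda>_. \<Omega>"]) auto
qed

definition indep_comb :: "'a set \<Rightarrow> 'a measure \<Rightarrow> 'a measure \<Rightarrow> 'a measure option" where
  "indep_comb \<Omega> P Q =
     (if \<exists>R. is_indep_comb \<Omega> P Q R then Some (THE R. is_indep_comb \<Omega> P Q R) else None)"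

lemma indep_comb_eq_Some_iff: "indep_comb \<Omega> P Q = Some R \<longleftrightarrow> is_indep_comb \<Omega> P Q R"
proof -
  have "(THE R. is_indep_comb \<Omega> P Q R) = S" if "is_indep_comb \<Omega> P Q S" for S
    using that is_indep_comb_unique by (blast intro: the_equality)
  then show ?thesis
    by (auto simp: indep_comb_def)
qed

definition triv_prob :: "'a set \<Rightarrow> 'a measure" where
  "triv_prob \<Omega> = measure_of \<Omega> {{}, \<Omega>} (\<lambda>A. if A = {} then 0 else 1)"

(* measure_of silently yields the null measure if its last argument is not countably additive;
   the next lemmas rule this out. *)

lemma space_triv_prob: "space (triv_prob \<Omega>) = \<Omega>"
  by (simp add: triv_prob_def)

lemma sets_triv_prob: "sets (triv_prob \<Omega>) = {{}, \<Omega>}"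
  unfolding triv_prob_def by (subst sets_measure_of) (auto simp: sigma_algebra.sigma_sets_eq[OF sigma_algebra_trivial])

lemma emeasure_triv_prob:
  assumes "\<Omega> \<noteq> {}"
  shows "emeasure (triv_prob \<Omega>) \<Omega> = 1"
proof -
  have "countably_additive {{}, \<Omega>} (\<lambda>A. if A = {} then 0 else 1 :: ennreal)"
  proof (rule countably_additiveI)
    fix A :: "nat \<Rightarrow> 'a set"
    assume A: "range A \<subseteq> {{}, \<Omega>}" and d: "disjoint_family A"
    show "(\<Sum>i. if A i = {} then 0 else 1 :: ennreal) = (if (\<Union>i. A i) = {} then 0 else 1)"
    proof (cases "\<exists>i. A i \<noteq> {}")
      case True
      then obtain i where i: "A i \<noteq> {}" by blast
      have "A j = {}" if "j \<noteq> i" for j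
        using A i that d assms unfolding disjoint_family_on_def
        by (metis Int_absorb UNIV_I insert_iff rangeI singletonD subsetD)
      then have "(\<Sum>i. if A i = {} then 0 else 1 :: ennreal) = (\<Sum>j\<in>{i}. if A j = {} then 0 else 1)"
        by (intro suminf_finite) auto
      then show ?thesis using i by auto
    qed simp
  qed
  then have "emeasure (triv_prob \<Omega>) \<Omega> = (if \<Omega> = {} then 0 else 1)"
    by (intro emeasure_measure_of[OF triv_prob_def]) (auto simp: sets_triv_prob positive_def)
  then show ?thesis using assms by simp
qed

end

(* Both the ordering axiom and associativity restrict the measure of a given combination to a
   smaller sigma-algebra.  If (P, Q, Z) combine to R, then Q and Z combine to the restriction V of R
   to the sigma-algebra they generate; P is independent of V under R because it is independent of
   the pi-system of the sets F \<inter> G with F in Q and G in Z, which generates V. *)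

theory Submission
  imports Defs "HOL-Probability.Conditional_Expectation" "HOL-Probability.Independent_Family"
begin

lemma prob_spacesD:
  assumes "P \<in> prob_spaces \<Omega>"
  shows "prob_space P" "space P = \<Omega>" "sets P \<subseteq> Pow \<Omega>" "\<Omega> \<in> sets P" "emeasure P \<Omega> = 1"
  using assms sets.space_closed[of P] sets.top[of P] prob_space.emeasure_space_1[of P]
  by (auto simp: prob_spaces_def)

lemma prob_le_antisym:
  assumes "prob_le P Q" "prob_le Q P"
  shows "P = Q"
  using assms by (intro measure_eqI) (auto simp: prob_le_def)

lemma prob_le_trans:
  assumes "prob_le P Q" "prob_le Q R"
  shows "prob_le P R"
  using assms by (auto simp: prob_le_def)

text \<open>The \<sigma>-algebra \<open>sets R\<close> contains \<open>G\<close> and hence all that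
  \<open>G\<close> generates, so \<open>R\<close> restricts to it, and the total mass stays 1. Every
  new space needed below for monotonicity and associativity comes from this restriction.\<close>

lemma prob_space_restriction_exists:
  assumes R: "R \<in> prob_spaces \<Omega>" and G: "G \<subseteq> sets R"
  obtains V where "V \<in> prob_spaces \<Omega>" "sets V = sigma_sets \<Omega> G" "prob_le V R"
proof
  note [simp] = prob_spacesD(2)[OF R]
  have sub: "subalgebra R (sigma \<Omega> G)"
    using G prob_spacesD(3)[OF R] sets.sigma_sets_subset[of G R]
    by (auto simp: subalgebra_def)
  let ?V = "restr_to_subalg R (sigma \<Omega> G)"
  show sets: "sets ?V = sigma_sets \<Omega> G"
    using G prob_spacesD(3)[OF R] by (subst sets_restr_to_subalg[OF sub]) auto
  show "prob_le ?V R"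
    using sub sets_restr_to_subalg[OF sub]
    by (auto simp: prob_le_def subalgebra_def emeasure_restr_to_subalg[OF sub])
  show "?V \<in> prob_spaces \<Omega>"
    using prob_space_restr_to_subalg[OF sub prob_spacesD(1)[OF R]]
    by (auto simp: prob_spaces_def space_restr_to_subalg)
qed

text \<open>Intersecting with \<Omega> recovers each factor, and a \<sigma>-algebra is closed under
  intersection. The gain is a generator that is itself closed under intersection, as a \<pi>-system
  argument requires.\<close>

lemma sigma_sets_Un_eq_Int:
  assumes "P \<in> prob_spaces \<Omega>" "Q \<in> prob_spaces \<Omega>"
  shows "sigma_sets \<Omega> (sets P \<union> sets Q) = sigma_sets \<Omega> {E \<inter> F | E F. E \<in> sets P \<and> F \<in> sets Q}"
    (is "?S = sigma_sets \<Omega> ?G")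
proof
  note P = prob_spacesD[OF assms(1)] and Q = prob_spacesD[OF assms(2)]
  interpret S: sigma_algebra \<Omega> ?S
    using P(3) Q(3) by (intro sigma_algebra_sigma_sets) auto
  show "sigma_sets \<Omega> ?G \<subseteq> ?S"
    by (rule sigma_sets_mono) auto
  have "A = A \<inter> \<Omega>" "A = \<Omega> \<inter> A" if "A \<in> sets P \<union> sets Q" for A
    using that P(3) Q(3) by auto
  then have "sets P \<union> sets Q \<subseteq> ?G"
    using P(4) Q(4) by blast
  then show "?S \<subseteq> sigma_sets \<Omega> ?G"
    by (rule sigma_sets_mono')
qed

lemma Int_stable_Int_sets: "Int_stable {E \<inter> F | E F. E \<in> sets P \<and> F \<in> sets Q}"
proof (rule Int_stableI)
  fix a b
  assume "a \<in> {E \<inter> F | E F. E \<in> sets P \<and> F \<in> sets Q}" "b \<in> {E \<inter> F | E F. E \<in> sets P \<and> F \<in> sets Q}"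
  then obtain E F E' F' where *: "a = E \<inter> F" "b = E' \<inter> F'"
    and "E \<in> sets P" "F \<in> sets Q" "E' \<in> sets P" "F' \<in> sets Q" by blast
  then have "a \<inter> b = (E \<inter> E') \<inter> (F \<inter> F')" "E \<inter> E' \<in> sets P" "F \<inter> F' \<in> sets Q"
    by auto
  then show "a \<inter> b \<in> {E \<inter> F | E F. E \<in> sets P \<and> F \<in> sets Q}" by blast
qed

lemma is_indep_combD:
  assumes "is_indep_comb \<Omega> P Q R"
  shows "P \<in> prob_spaces \<Omega>" "Q \<in> prob_spaces \<Omega>" "R \<in> prob_spaces \<Omega>"
    and "sets R = sigma_sets \<Omega> (sets P \<union> sets Q)"
    and "\<And>E F. E \<in> sets P \<Longrightarrow> F \<in> sets Q \<Longrightarrow> emeasure R (E \<inter> F) = emeasure P E * emeasure Q F"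
  using assms by (auto simp: is_indep_comb_def)

lemma is_indep_comb_commute: "is_indep_comb \<Omega> P Q R \<longleftrightarrow> is_indep_comb \<Omega> Q P R"
  unfolding is_indep_comb_def by (metis Int_commute Un_commute mult.commute)

text \<open>Take the second event in the product formula to be \<Omega>, which has mass 1 under
  \<open>Q\<close>.\<close>

lemma is_indep_comb_prob_le_left:
  assumes "is_indep_comb \<Omega> P Q R"
  shows "prob_le P R"
proof -
  note D = is_indep_combD[OF assms]
  have "emeasure P A = emeasure R A" if "A \<in> sets P" for A
    using D(5)[OF that prob_spacesD(4)[OF D(2)]] that prob_spacesD(3)[OF D(1)]
      prob_spacesD(5)[OF D(2)]
    by (auto simp: Int_absorb2)
  then show ?thesis
    by (auto simp: prob_le_def D(4))
qed

lemma is_indep_comb_prob_le_right: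
  assumes "is_indep_comb \<Omega> P Q R"
  shows "prob_le Q R"
  using assms is_indep_comb_commute is_indep_comb_prob_le_left by blast

lemma triv_prob_in_prob_spaces:
  assumes "\<Omega> \<noteq> {}"
  shows "triv_prob \<Omega> \<in> prob_spaces \<Omega>"
  using emeasure_triv_prob[OF assms]
  by (auto simp: prob_spaces_def space_triv_prob intro!: prob_spaceI)

text \<open>The trivial \<sigma>-algebra adds no sets to \<open>sets P\<close>, and every event is
  independent of the empty set and of \<Omega>.\<close>

lemma is_indep_comb_triv_prob:
  assumes "\<Omega> \<noteq> {}" and P: "P \<in> prob_spaces \<Omega>"
  shows "is_indep_comb \<Omega> P (triv_prob \<Omega>) P"
proof -
  note D = prob_spacesD[OF P]
  have "sets P \<union> {{}, \<Omega>} = sets P"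
    using D(4) by auto
  then have "sets P = sigma_sets \<Omega> (sets P \<union> {{}, \<Omega>})"
    using sets.sigma_sets_eq[of P] D(2) by simp
  then show ?thesis
    using P D(3) triv_prob_in_prob_spaces[OF assms(1)]
    by (auto simp: is_indep_comb_def sets_triv_prob emeasure_triv_prob assms(1) Int_absorb2)
qed

text \<open>The witness is the restriction of \<open>R'\<close> to the \<sigma>-algebra generated by
  \<open>P\<close> and \<open>Q\<close>. It inherits the product formula, since \<open>P'\<close>
  and \<open>Q'\<close> agree with \<open>P\<close> and \<open>Q\<close> on the smaller
  \<sigma>-algebras.\<close>

lemma is_indep_comb_mono:
  assumes PQ: "P \<in> prob_spaces \<Omega>" "Q \<in> prob_spaces \<Omega>"
    and le: "prob_le P P'" "prob_le Q Q'" and R': "is_indep_comb \<Omega> P' Q' R'"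
  obtains R where "is_indep_comb \<Omega> P Q R" "prob_le R R'"
proof -
  have sub: "sets P \<union> sets Q \<subseteq> sets R'"
    using le is_indep_comb_prob_le_left[OF R'] is_indep_comb_prob_le_right[OF R']
    by (auto simp: prob_le_def)
  obtain R where R: "R \<in> prob_spaces \<Omega>" "sets R = sigma_sets \<Omega> (sets P \<union> sets Q)" "prob_le R R'"
    using prob_space_restriction_exists[OF is_indep_combD(3)[OF R'] sub] .
  have "emeasure R (E \<inter> F) = emeasure P E * emeasure Q F" if "E \<in> sets P" "F \<in> sets Q" for E F
  proof -
    have "E \<in> sets R" "F \<in> sets R"
      using that R(2) by auto
    then have "emeasure R (E \<inter> F) = emeasure R' (E \<inter> F)"
      using R(3) by (auto simp: prob_le_def)
    also have "\<dots> = emeasure P E * emeasure Q F"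
      using is_indep_combD(5)[OF R', of E F] that le by (auto simp: prob_le_def subset_iff)
    finally show ?thesis .
  qed
  then have "is_indep_comb \<Omega> P Q R"
    using PQ R by (auto simp: is_indep_comb_def)
  then show ?thesis
    using R(3) that by blast
qed

text \<open>This is one direction of associativity, including that the right-hand side is defined
  whenever the left-hand side is. Commutativity turns it into the other direction.\<close>

lemma is_indep_comb_assoc:
  assumes W: "is_indep_comb \<Omega> P Q W" and R: "is_indep_comb \<Omega> W Z R"
  obtains V where "is_indep_comb \<Omega> Q Z V" "is_indep_comb \<Omega> P V R"
proof -
  note DW = is_indep_combD[OF W] and DR = is_indep_combD[OF R]
  have QW: "prob_le Q W" and WR: "prob_le W R" and ZR: "prob_le Z R"
    using is_indep_comb_prob_le_right[OF W] is_indep_comb_prob_le_left[OF R]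
      is_indep_comb_prob_le_right[OF R] .
  have PR: "prob_le P R"
    using prob_le_trans[OF is_indep_comb_prob_le_left[OF W] WR] .
  \<comment> \<open>\<open>Q\<close> lies below \<open>W\<close> and \<open>Z\<close> below itself,
    so monotonicity applied to the combination \<open>R\<close> of \<open>W\<close> and
    \<open>Z\<close> yields \<open>V\<close>.\<close>
  obtain V where V: "is_indep_comb \<Omega> Q Z V" "prob_le V R"
    using is_indep_comb_mono[OF DW(2) DR(2) QW _ R] by (auto simp: prob_le_def)
  note DV = is_indep_combD[OF V(1)]
  let ?G = "{F \<inter> G | F G. F \<in> sets Q \<and> G \<in> sets Z}"
  have sV: "sets V = sigma_sets \<Omega> ?G"
    using DV(4) sigma_sets_Un_eq_Int[OF DW(2) DR(2)] by simp
  then have GV: "?G \<subseteq> sets V" by auto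
  interpret R: prob_space R
    using prob_spacesD(1)[OF DR(3)] .
  \<comment> \<open>Regrouping as \<open>(E \<inter> F) \<inter> G\<close> lets the product formulas
    of \<open>R\<close>, \<open>W\<close> and \<open>V\<close> apply in turn. Since \<open>P\<close>
    and \<open>V\<close> lie below \<open>R\<close>, all values can then be read off
    \<open>R\<close>.\<close>
  have gen: "emeasure R (E \<inter> (F \<inter> G)) = emeasure R E * emeasure R (F \<inter> G)"
    if "E \<in> sets P" "F \<in> sets Q" "G \<in> sets Z" for E F G
  proof -
    have EF: "E \<inter> F \<in> sets W"
      using that is_indep_comb_prob_le_left[OF W] QW
      by (intro sets.Int) (auto simp: prob_le_def)
    have "emeasure R (E \<inter> (F \<inter> G)) = emeasure R ((E \<inter> F) \<inter> G)"
      by (simp add: Int_assoc)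
    also have "\<dots> = emeasure P E * (emeasure Q F * emeasure Z G)"
      using DR(5)[OF EF that(3)] DW(5) that by (simp add: mult.assoc)
    also have "\<dots> = emeasure P E * emeasure V (F \<inter> G)"
      using DV(5) that by simp
    also have "\<dots> = emeasure R E * emeasure R (F \<inter> G)"
    proof -
      have "F \<inter> G \<in> sets V" using that GV by blast
      then show ?thesis using that(1) PR V(2) by (simp add: prob_le_def)
    qed
    finally show ?thesis .
  qed
  have "R.indep_set (sets P) ?G"
    unfolding R.indep_sets2_eq
  proof (intro conjI ballI)
    show "sets P \<subseteq> R.events" "?G \<subseteq> R.events"
      using PR V(2) GV by (auto simp: prob_le_def)
    fix E A assume "E \<in> sets P" "A \<in> ?G"
    then have "emeasure R (E \<inter> A) = emeasure R E * emeasure R A"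
      using gen by auto
    then show "R.prob (E \<inter> A) = R.prob E * R.prob A"
      by (simp add: measure_def enn2real_mult)
  qed
  \<comment> \<open>Both families are closed under intersection, so independence passes to the
    \<sigma>-algebras that they generate.\<close>
  then have "R.indep_set (sigma_sets (space R) (sets P)) (sigma_sets (space R) ?G)"
    by (rule R.indep_set_sigma_sets) (auto simp: Int_stable_Int_sets sets.Int_stable)
  then have indep: "R.indep_set (sets P) (sets V)"
    using sV sets.sigma_sets_eq[of P] prob_spacesD(2)[OF DW(1)] prob_spacesD(2)[OF DR(3)] by simp
  have "emeasure R (E \<inter> A) = emeasure P E * emeasure V A" if "E \<in> sets P" "A \<in> sets V" for E A
  proof -
    \<comment> \<open>\<open>indep_set\<close> speaks of the real-valued \<open>R.prob\<close>; as
      \<open>R\<close> is finite, the product rule carries back to \<open>emeasure\<close>.\<close>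
    have "emeasure R (E \<inter> A) = emeasure R E * emeasure R A"
      using indep that by (simp add: R.indep_sets2_eq R.emeasure_eq_measure ennreal_mult)
    then show ?thesis
      using that PR V(2) by (simp add: prob_le_def)
  qed
  \<comment> \<open>Both sides are the \<sigma>-algebra generated by \<open>P\<close>,
    \<open>Q\<close> and \<open>Z\<close> together: \<open>W\<close> is generated by
    \<open>P\<close> and \<open>Q\<close>, and \<open>V\<close> contains \<open>Q\<close> and
    \<open>Z\<close>.\<close>
  moreover have "sets R = sigma_sets \<Omega> (sets P \<union> sets V)"
  proof
    have WZ: "sets W \<union> sets Z \<subseteq> sigma_sets \<Omega> (sets P \<union> sets V)"
    proof -
      have "sets Q \<union> sets Z \<subseteq> sets V"
        using DV(4) by auto
      then show ?thesis
        using DW(4) sigma_sets_mono'[of "sets P \<union> sets Q" "sets P \<union> sets V" \<Omega>] by auto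
    qed
    show "sets R \<subseteq> sigma_sets \<Omega> (sets P \<union> sets V)"
      unfolding DR(4) by (rule sigma_sets_mono[OF WZ])
    show "sigma_sets \<Omega> (sets P \<union> sets V) \<subseteq> sets R"
      using sets.sigma_sets_subset[of "sets P \<union> sets V" R] PR V(2) prob_spacesD(2)[OF DR(3)]
      by (simp add: prob_le_def)
  qed
  ultimately have "is_indep_comb \<Omega> P V R"
    using DW(1) DV(3) DR(3) by (auto simp: is_indep_comb_def)
  then show ?thesis
    using V(1) that by blast
qed

theorem theorem2p4:
  fixes \<Omega> :: "'a set"
  assumes "\<Omega> \<noteq> {}"
  shows "kripke_resource_monoid (prob_spaces \<Omega>) prob_le (indep_comb \<Omega>) (triv_prob \<Omega>)"
proof
  show "reflp_on (prob_spaces \<Omega>) prob_le"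
    by (auto simp: reflp_on_def prob_le_def)
  show "antisymp_on (prob_spaces \<Omega>) prob_le"
    by (auto simp: antisymp_on_def intro: prob_le_antisym)
  show "transp_on (prob_spaces \<Omega>) prob_le"
    by (auto simp: transp_on_def intro: prob_le_trans)
  show "z \<in> prob_spaces \<Omega>" if "indep_comb \<Omega> x y = Some z" for x y z
    using that is_indep_combD(3) by (auto simp: indep_comb_eq_Some_iff)
  show "triv_prob \<Omega> \<in> prob_spaces \<Omega>"
    using assms by (rule triv_prob_in_prob_spaces)
  show "indep_comb \<Omega> x (triv_prob \<Omega>) = Some x" if "x \<in> prob_spaces \<Omega>" for x
    using is_indep_comb_triv_prob[OF assms that] by (simp add: indep_comb_eq_Some_iff)
  show "indep_comb \<Omega> x y = indep_comb \<Omega> y x" for x y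
  proof -
    \<comment> \<open>Equality of the two predicates makes both the existence test and the
      \<open>THE\<close> term in \<open>indep_comb\<close> agree.\<close>
    have "is_indep_comb \<Omega> x y = is_indep_comb \<Omega> y x"
      using is_indep_comb_commute by blast
    then show ?thesis
      by (simp add: indep_comb_def)
  qed
  show "Option.bind (indep_comb \<Omega> x y) (\<lambda>w. indep_comb \<Omega> w z) =
      Option.bind (indep_comb \<Omega> y z) (\<lambda>w. indep_comb \<Omega> x w)" for x y z
  proof -
    \<comment> \<open>Comparing the two sides at every defined value \<open>r\<close> also settles
      definedness. For the converse, commute everything, so that the right-hand side reads
      \<open>(z y) x\<close>, reassociate to \<open>z (y x)\<close>, and commute back.\<close>
    have "Option.bind (indep_comb \<Omega> x y) (\<lambda>w. indep_comb \<Omega> w z) = Some r \<longleftrightarrow>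
        Option.bind (indep_comb \<Omega> y z) (\<lambda>w. indep_comb \<Omega> x w) = Some r" for r
      unfolding bind_eq_Some_conv indep_comb_eq_Some_iff
      by (metis is_indep_comb_assoc is_indep_comb_commute)
    then show ?thesis
      by (metis not_Some_eq)
  qed
  show "\<exists>z. indep_comb \<Omega> x y = Some z \<and> prob_le z z'"
    if "x \<in> prob_spaces \<Omega>" "y \<in> prob_spaces \<Omega>" "prob_le x x'" "prob_le y y'"
      "indep_comb \<Omega> x' y' = Some z'" for x x' y y' z'
    using that is_indep_comb_mono[of x \<Omega> y x' y' z'] by (auto simp: indep_comb_eq_Some_iff)
qed

end
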